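(* Let $G$ be a graph without isolated vertices. Then $\chi'_{sCF}(G)\le 2\lceil\log_2\chi(G)\rceil$ and $\chi'_{CF}(G)\le 2\lceil\log_2\chi(G)\rceil+1$.
   Context: All graphs are finite and simple. $\chi(G)$ denotes the (usual, vertex) chromatic number of $G$. For a graph $G$ and a vertex $v$, $E_G(v)$ denotes the set of edges of $G$ incident with $v$, and for an edge $uv\in E(G)$ its closed neighborhood is $E_G[uv]:=E_G(u)\cup E_G(v)$ (this contains $uv$ itself). An edge $k$-coloring of a graph is any assignment of colors from $\{1,\dots,k\}$ to its edges (not necessarily proper). Given an edge coloring $\varphi$ of a subgraph $H$ of $G$ (that is, a partial edge coloring of $G$, coloring exactly the edges in $E(H)$), an edge $uv\in E(G)$ is satisfied by $\varphi$ if there is a color that appears exactly once (that is, on exactly one edge) in $E_G[uv]\cap E(H)$. An edge coloring of all of $G$ is conflict-free if every edge of $G$ is satisfied (case $H=G$). The conflict-free chromatic index $\chi'_{CF}(G)$ is the least number of colors in a conflict-free edge coloring of $G$. The parameter $\chi'_{sCF}(G)$ is the least number of colors required for coloring the edges of some subgraph $H$ of $G$ such that all edges of $G$ (colored or not) are satisfied. *)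

theory Defs
  imports Complex_Main
begin

definition simple_graph :: "'a set \<Rightarrow> 'a set set \<Rightarrow> bool" where
  "simple_graph V E \<longleftrightarrow> finite V \<and> (\<forall>e\<in>E. e \<subseteq> V \<and> card e = 2)"

definition subgraph :: "'a set \<Rightarrow> 'a set set \<Rightarrow> 'a set \<Rightarrow> 'a set set \<Rightarrow> bool" where
  "subgraph W F V E \<longleftrightarrow> simple_graph W F \<and> W \<subseteq> V \<and> F \<subseteq> E"

definition incident_edges :: "'a set set \<Rightarrow> 'a \<Rightarrow> 'a set set" where
  "incident_edges E v = {e \<in> E. v \<in> e}"

definition isolated :: "'a set set \<Rightarrow> 'a \<Rightarrow> bool" where
  "isolated E v \<longleftrightarrow> incident_edges E v = {}"

definition closed_edge_nbhd :: "'a set set \<Rightarrow> 'a \<Rightarrow> 'a \<Rightarrow> 'a set set" where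
  "closed_edge_nbhd E u v = incident_edges E u \<union> incident_edges E v"

definition proper_vertex_coloring :: "'a set \<Rightarrow> 'a set set \<Rightarrow> nat \<Rightarrow> ('a \<Rightarrow> nat) \<Rightarrow> bool" where
  "proper_vertex_coloring V E k c \<longleftrightarrow>
     c ` V \<subseteq> {1..k} \<and> (\<forall>u v. {u, v} \<in> E \<longrightarrow> c u \<noteq> c v)"

definition chromatic_number :: "'a set \<Rightarrow> 'a set set \<Rightarrow> nat" where
  "chromatic_number V E = (LEAST k. \<exists>c. proper_vertex_coloring V E k c)"

text \<open>A partial edge coloring of a graph with edge set \<open>E\<close> is given by the set \<open>F \<subseteq> E\<close> of its
  colored edges together with a total function \<open>\<phi>\<close> whose values outside \<open>F\<close> are irrelevant.\<close>

definition edge_coloring :: "'a set set \<Rightarrow> nat \<Rightarrow> ('a set \<Rightarrow> nat) \<Rightarrow> bool" where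
  "edge_coloring F k \<phi> \<longleftrightarrow> \<phi> ` F \<subseteq> {1..k}"

definition satisfied :: "'a set set \<Rightarrow> 'a set set \<Rightarrow> ('a set \<Rightarrow> nat) \<Rightarrow> 'a \<Rightarrow> 'a \<Rightarrow> bool" where
  "satisfied E F \<phi> u v \<longleftrightarrow> (\<exists>c. \<exists>!e. e \<in> closed_edge_nbhd E u v \<inter> F \<and> \<phi> e = c)"

definition all_satisfied :: "'a set set \<Rightarrow> 'a set set \<Rightarrow> ('a set \<Rightarrow> nat) \<Rightarrow> bool" where
  "all_satisfied E F \<phi> \<longleftrightarrow> (\<forall>u v. {u, v} \<in> E \<longrightarrow> satisfied E F \<phi> u v)"

definition conflict_free :: "'a set set \<Rightarrow> ('a set \<Rightarrow> nat) \<Rightarrow> bool" where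
  "conflict_free E \<phi> \<longleftrightarrow> all_satisfied E E \<phi>"

definition cf_index :: "'a set set \<Rightarrow> nat" where
  "cf_index E = (LEAST k. \<exists>\<phi>. edge_coloring E k \<phi> \<and> conflict_free E \<phi>)"

definition scf_index :: "'a set \<Rightarrow> 'a set set \<Rightarrow> nat" where
  "scf_index V E =
     (LEAST k. \<exists>W F \<phi>. subgraph W F V E \<and> edge_coloring F k \<phi> \<and> all_satisfied E F \<phi>)"

text \<open>For a finite simple graph the three minima above range over nonempty sets, so \<open>LEAST\<close>
  denotes an attained value.\<close>

lemma simple_graph_finite_edges:
  assumes "simple_graph V E"
  shows "finite E"
proof -
  have "E \<subseteq> Pow V" and "finite V"
    using assms by (auto simp: simple_graph_def)
  then show ?thesis
    using finite_subset by blast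
qed

lemma finite_inj_into_interval:
  assumes "finite A"
  obtains f :: "'b \<Rightarrow> nat" where "inj_on f A" "f ` A \<subseteq> {1..card A}"
proof -
  obtain f where "bij_betw f A {1..card A}"
    using finite_same_card_bij[OF assms, of "{1..card A}"] by auto
  then show ?thesis
    using that[of f] by (auto simp: bij_betw_def)
qed

lemma chromatic_number_attained:
  assumes "simple_graph V E"
  shows "\<exists>c. proper_vertex_coloring V E (chromatic_number V E) c"
proof -
  have "finite V"
    using assms by (simp add: simple_graph_def)
  then obtain c :: "'a \<Rightarrow> nat" where c: "inj_on c V" "c ` V \<subseteq> {1..card V}"
    by (rule finite_inj_into_interval)
  have "c u \<noteq> c v" if "{u, v} \<in> E" for u v
  proof -
    have "{u, v} \<subseteq> V" "card {u, v} = 2"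
      using assms that by (auto simp: simple_graph_def)
    then have "u \<in> V" "v \<in> V" "u \<noteq> v"
      by auto
    then show ?thesis
      using c(1) by (auto dest: inj_onD)
  qed
  then have "\<exists>k c. proper_vertex_coloring V E k c"
    using c(2) unfolding proper_vertex_coloring_def by blast
  then show ?thesis
    unfolding chromatic_number_def by (rule LeastI_ex)
qed

lemma conflict_free_exists:
  assumes "simple_graph V E"
  shows "\<exists>k \<phi>. edge_coloring E k \<phi> \<and> conflict_free E \<phi>"
proof -
  obtain \<phi> :: "'a set \<Rightarrow> nat" where \<phi>: "inj_on \<phi> E" "\<phi> ` E \<subseteq> {1..card E}"
    using simple_graph_finite_edges[OF assms] by (rule finite_inj_into_interval)
  have "satisfied E E \<phi> u v" if "{u, v} \<in> E" for u v
  proof -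
    have "\<exists>!e. e \<in> closed_edge_nbhd E u v \<inter> E \<and> \<phi> e = \<phi> {u, v}"
      using that \<phi>(1)
      by (intro ex1I[of _ "{u, v}"])
        (auto simp: closed_edge_nbhd_def incident_edges_def dest: inj_onD)
    then show ?thesis
      unfolding satisfied_def by blast
  qed
  then show ?thesis
    using \<phi>(2) unfolding edge_coloring_def conflict_free_def all_satisfied_def by blast
qed

lemma cf_index_attained:
  assumes "simple_graph V E"
  shows "\<exists>\<phi>. edge_coloring E (cf_index E) \<phi> \<and> conflict_free E \<phi>"
  unfolding cf_index_def by (rule LeastI_ex) (rule conflict_free_exists[OF assms])

lemma scf_index_attained:
  assumes "simple_graph V E"
  shows "\<exists>W F \<phi>. subgraph W F V E \<and> edge_coloring F (scf_index V E) \<phi> \<and> all_satisfied E F \<phi>"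
proof -
  have "subgraph V E V E"
    using assms by (simp add: subgraph_def)
  then have "\<exists>k W F \<phi>. subgraph W F V E \<and> edge_coloring F k \<phi> \<and> all_satisfied E F \<phi>"
    using conflict_free_exists[OF assms] unfolding conflict_free_def by blast
  then show ?thesis
    unfolding scf_index_def by (rule LeastI_ex)
qed

end

theory Submission
  imports Defs
begin

text \<open>
  A bipartite graph needs only two colors on a suitable subgraph. Let \<open>S\<close> be one side and let
  \<open>D\<close> be a minimal set of vertices on the other side such that every non-isolated vertex of
  \<open>S\<close> has a neighbor in \<open>D\<close>. By minimality every \<open>d \<in> D\<close> has a private neighbor \<open>p d \<in> S\<close>,
  whose only neighbor in \<open>D\<close> is \<open>d\<close>. Color the edges joining each \<open>d\<close> to \<open>p d\<close> with 2, and join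
  every other non-isolated vertex of \<open>S\<close> to \<open>D\<close> by one edge of color 1. An edge \<open>uv\<close> with
  \<open>u \<in> S\<close> and \<open>v \<notin> D\<close> sees a single colored edge, the one at \<open>u\<close>. If \<open>v \<in> D\<close>, it sees color 2
  exactly once, on the edge from \<open>v\<close> to \<open>p v\<close>: a second edge of color 2 would have to be at \<open>u\<close>,
  and then \<open>u\<close> would be the private neighbor of some other \<open>d \<in> D\<close> while being adjacent to \<open>v\<close>
  (\<open>bipartite_two_colors\<close>).

  If an edge set is partitioned into two parts that are treated with disjoint palettes, then no
  color of one part can disturb an edge of the other
  (\<open>all_satisfied_disjoint_union\<close>). A vertex coloring with at most \<open>2 ^ k\<close>
  colors, read in binary, partitions the edges into \<open>k\<close> bipartite graphs, the \<open>i\<close>-th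
  consisting of the edges whose ends first differ in bit \<open>i\<close>; hence \<open>2 * k\<close> colors suffice
  (\<open>binary_partial_coloring\<close>). One additional color on all uncolored edges makes the coloring
  total and preserves every color that was seen exactly once
  (\<open>conflict_free_extension\<close>).
\<close>

section \<open>Binary logarithms rounded up\<close>

text \<open>The value \<open>n = 0\<close> occurs for the empty graph, where \<open>log 2 0 = 0\<close> by the convention
  \<open>ln 0 = 0\<close>.\<close>

lemma ceiling_log_two:
  obtains k where "int k = \<lceil>log 2 (real n)\<rceil>" and "n \<le> 2 ^ k"
proof (cases "n = 0")
  case True
  then have "int 0 = \<lceil>log 2 (real n)\<rceil>" "n \<le> 2 ^ 0"
    by (simp_all add: log_def)
  then show ?thesis
    by (rule that)
next
  case False
  define k where "k = nat \<lceil>log 2 (real n)\<rceil>"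
  have "0 \<le> log 2 (real n)"
    using False by simp
  then have "int k = \<lceil>log 2 (real n)\<rceil>"
    by (simp add: k_def)
  moreover have "real n \<le> real (2 ^ k)"
  proof -
    have "real n = 2 powr log 2 (real n)"
      using False by simp
    also have "\<dots> \<le> 2 powr real k"
      unfolding k_def by (intro powr_mono real_nat_ceiling_ge) simp
    also have "\<dots> = real (2 ^ k)"
      by (simp add: powr_realpow)
    finally show ?thesis .
  qed
  then have "n \<le> 2 ^ k"
    by (rule of_nat_le_iff[THEN iffD1])
  ultimately show ?thesis
    by (rule that)
qed

section \<open>Satisfied edges\<close>

text \<open>The color that appears once is named by the edge that carries it, which removes the
  quantifier over colors and leaves a condition on edges of \<open>F\<close> alone.\<close>

lemma satisfied_iff:
  assumes "F \<subseteq> E"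
  shows "satisfied E F \<phi> u v \<longleftrightarrow>
    (\<exists>e\<in>F. (u \<in> e \<or> v \<in> e) \<and> (\<forall>e'\<in>F. u \<in> e' \<or> v \<in> e' \<longrightarrow> \<phi> e' = \<phi> e \<longrightarrow> e' = e))"
proof -
  have nbhd: "e \<in> closed_edge_nbhd E u v \<inter> F \<longleftrightarrow> e \<in> F \<and> (u \<in> e \<or> v \<in> e)" for e
    using assms by (auto simp: closed_edge_nbhd_def incident_edges_def)
  show ?thesis (is "_ \<longleftrightarrow> ?R")
  proof
    assume "satisfied E F \<phi> u v"
    then obtain c e where "e \<in> F \<and> (u \<in> e \<or> v \<in> e)" "\<phi> e = c"
      and "\<And>e'. (e' \<in> F \<and> (u \<in> e' \<or> v \<in> e')) \<and> \<phi> e' = c \<Longrightarrow> e' = e"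
      unfolding satisfied_def nbhd by (elim exE ex1E) blast
    then show ?R
      by (intro bexI[of _ e]) simp_all
  next
    assume ?R
    then obtain e where "e \<in> F" "u \<in> e \<or> v \<in> e"
      and "\<And>e'. e' \<in> F \<Longrightarrow> u \<in> e' \<or> v \<in> e' \<Longrightarrow> \<phi> e' = \<phi> e \<Longrightarrow> e' = e"
      by blast
    then have "\<exists>!e'. (e' \<in> F \<and> (u \<in> e' \<or> v \<in> e')) \<and> \<phi> e' = \<phi> e"
      by (intro ex1I[of _ e]) simp_all
    then show "satisfied E F \<phi> u v"
      unfolding satisfied_def nbhd by (rule exI)
  qed
qed

lemma satisfied_commute: "satisfied E F \<phi> u v \<longleftrightarrow> satisfied E F \<phi> v u"
  by (simp add: satisfied_def closed_edge_nbhd_def Un_commute)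

section \<open>Two colors for bipartite graphs\<close>

text \<open>Deleting \<open>d\<close> from a minimal \<open>D\<close> leaves some vertex of \<open>A\<close> without a neighbor in the rest of
  \<open>D\<close>; that vertex is a private neighbor of \<open>d\<close>.\<close>

lemma dominating_set_with_private_neighbors:
  assumes "finite B" and "\<And>a. a \<in> A \<Longrightarrow> \<exists>b\<in>B. R a b"
  obtains D where "D \<subseteq> B" and "\<forall>a\<in>A. \<exists>d\<in>D. R a d"
    and "\<forall>d\<in>D. \<exists>a\<in>A. \<forall>d'\<in>D. R a d' \<longleftrightarrow> d' = d"
proof -
  let ?dom = "\<lambda>D. D \<subseteq> B \<and> (\<forall>a\<in>A. \<exists>d\<in>D. R a d)"
  have "?dom B"
    using assms(2) by blast
  then obtain D where D: "?dom D" and min: "\<And>D'. ?dom D' \<Longrightarrow> card D \<le> card D'"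
    using ex_has_least_nat[of ?dom B card] by blast
  have "\<exists>a\<in>A. \<forall>d'\<in>D. R a d' \<longleftrightarrow> d' = d" if "d \<in> D" for d
  proof -
    have "finite D"
      using D assms(1) finite_subset by blast
    then have "card (D - {d}) < card D"
      using that by (rule card_Diff1_less)
    then have "\<not> ?dom (D - {d})"
      using min leD by blast
    then show ?thesis
      using D by blast
  qed
  with D show ?thesis
    using that by blast
qed

text \<open>The colored edges form stars centered at \<open>D\<close>, each with exactly one edge of color 2. The center
  of a star may have many edges of color 1, which is harmless because color 2 serves all edges at
  a center; the edges that miss \<open>D\<close> are served by the unique star edge at their end in \<open>S\<close>.\<close>

lemma bipartite_two_colors:
  fixes E :: "'a set set"
  assumes "finite (\<Union>E)"
    and card2: "\<And>e. e \<in> E \<Longrightarrow> card e = 2"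
    and bip: "\<And>u v. {u, v} \<in> E \<Longrightarrow> (u \<in> S) \<noteq> (v \<in> S)"
  shows "\<exists>F \<phi>. F \<subseteq> E \<and> edge_coloring F 2 \<phi> \<and> all_satisfied E F \<phi>"
proof -
  define A where "A = S \<inter> \<Union>E"
  have nbr: "\<exists>b\<in>\<Union>E - S. {a, b} \<in> E" if a: "a \<in> A" for a
  proof -
    obtain e where e: "e \<in> E" "a \<in> e"
      using a by (auto simp: A_def)
    obtain x y where "e = {x, y}"
      using card2[OF e(1)] by (meson card_2_iff)
    then obtain b where "e = {a, b}"
      using e(2) by auto
    then have "{a, b} \<in> E"
      using e(1) by simp
    then show ?thesis
      using bip[of a b] a unfolding A_def by blast
  qed
  have "finite (\<Union>E - S)"
    using assms(1) by blast
  then obtain D where D: "D \<subseteq> \<Union>E - S" "\<forall>a\<in>A. \<exists>d\<in>D. {a, d} \<in> E"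
    and priv: "\<forall>d\<in>D. \<exists>a\<in>A. \<forall>d'\<in>D. {a, d'} \<in> E \<longleftrightarrow> d' = d"
    using nbr
    by (rule dominating_set_with_private_neighbors[of "\<Union>E - S" A "\<lambda>a b. {a, b} \<in> E"])
  obtain f where f: "\<And>a. a \<in> A \<Longrightarrow> f a \<in> D \<and> {a, f a} \<in> E"
    using D(2) by metis
  obtain p where p: "\<And>d. d \<in> D \<Longrightarrow> p d \<in> A"
    and p_only: "\<And>d d'. d \<in> D \<Longrightarrow> d' \<in> D \<Longrightarrow> {p d, d'} \<in> E \<longleftrightarrow> d' = d"
    using priv by metis
  have fp: "f (p d) = d" if "d \<in> D" for d
    using f p p_only that by metis
  define F where "F = (\<lambda>a. {a, f a}) ` A"
  define M where "M = (\<lambda>d. {p d, d}) ` D"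
  define \<phi> where "\<phi> e = (if e \<in> M then 2 else 1 :: nat)" for e
  have AS: "a \<in> S" if "a \<in> A" for a
    using that by (simp add: A_def)
  have DS: "d \<notin> S" if "d \<in> D" for d
    using that D(1) by blast
  have FE: "F \<subseteq> E"
    using f by (auto simp: F_def)
  \<comment> \<open>Since \<open>p d\<close> has no neighbor in \<open>D\<close> but \<open>d\<close>, the choice of \<open>f\<close> is forced there, so each
    color-2 edge is among the star edges.\<close>
  have MF: "M \<subseteq> F"
  proof
    fix e
    assume "e \<in> M"
    then obtain d where "d \<in> D" "e = {p d, d}"
      by (auto simp: M_def)
    then have "p d \<in> A" "e = {p d, f (p d)}"
      by (simp_all add: p fp)
    then show "e \<in> F"
      unfolding F_def by blast
  qed
  have sat: "satisfied E F \<phi> u v" if uv: "{u, v} \<in> E" and uS: "u \<in> S" for u v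
  proof -
    have vS: "v \<notin> S" and uA: "u \<in> A"
      using bip[OF uv] uS uv by (auto simp: A_def)
    show ?thesis
    proof (cases "v \<in> D")
      case True
      have "e = {p v, v}" if e: "e \<in> M" "u \<in> e \<or> v \<in> e" for e
      proof -
        obtain d where d: "d \<in> D" "e = {p d, d}"
          using e(1) by (auto simp: M_def)
        have "u \<noteq> d" "v \<noteq> p d"
          using AS[OF p[OF d(1)]] DS[OF d(1)] uS vS by blast+
        then have "u = p d \<or> v = d"
          using e(2) d(2) by simp
        \<comment> \<open>If \<open>u = p d\<close>, then \<open>v\<close> is a neighbor of \<open>p d\<close> in \<open>D\<close>.\<close>
        then have "v = d"
          using p_only[OF d(1) True] uv by blast
        then show ?thesis
          using d(2) by simp
      qed
      moreover have pv: "{p v, v} \<in> M"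
        using True by (auto simp: M_def)
      moreover have "\<phi> e = \<phi> {p v, v} \<longleftrightarrow> e \<in> M" for e
        using pv by (simp add: \<phi>_def)
      ultimately show ?thesis
        unfolding satisfied_iff[OF FE] using MF by (intro bexI[of _ "{p v, v}"]) blast+
    next
      case False
      have "e = {u, f u}" if e: "e \<in> F" "u \<in> e \<or> v \<in> e" for e
      proof -
        obtain a where a: "a \<in> A" "e = {a, f a}"
          using e(1) by (auto simp: F_def)
        have "f a \<in> D"
          using f a(1) by blast
        then have "a = u"
          using e(2) a(2) AS[OF a(1)] DS[of "f a"] uS vS False by auto
        then show ?thesis
          using a(2) by simp
      qed
      moreover have "{u, f u} \<in> F"
        using uA by (auto simp: F_def)
      ultimately show ?thesis
        unfolding satisfied_iff[OF FE] by blast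
    qed
  qed
  have "satisfied E F \<phi> u v" if "{u, v} \<in> E" for u v
  proof (cases "u \<in> S")
    case True
    then show ?thesis
      using sat that by blast
  next
    case False
    then have "satisfied E F \<phi> v u"
      using sat[of v u] bip[OF that] that by (simp add: insert_commute)
    then show ?thesis
      by (simp add: satisfied_commute)
  qed
  moreover have "edge_coloring F 2 \<phi>"
    by (auto simp: edge_coloring_def \<phi>_def)
  ultimately show ?thesis
    using FE unfolding all_satisfied_def by blast
qed

section \<open>Disjoint palettes and binary expansions\<close>

text \<open>Shifting the second palette by \<open>m\<close> separates it from the first, so the unique color that an
  edge sees in its own part appears nowhere in the other part.\<close>

lemma all_satisfied_disjoint_union:
  assumes "E1 \<inter> E2 = {}" and F1: "F1 \<subseteq> E1" and F2: "F2 \<subseteq> E2"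
    and col1: "edge_coloring F1 m \<phi>1" and col2: "edge_coloring F2 n \<phi>2"
    and sat1: "all_satisfied E1 F1 \<phi>1" and sat2: "all_satisfied E2 F2 \<phi>2"
  defines "\<psi> \<equiv> \<lambda>e. if e \<in> F1 then \<phi>1 e else m + \<phi>2 e"
  shows "edge_coloring (F1 \<union> F2) (m + n) \<psi>"
    and "all_satisfied (E1 \<union> E2) (F1 \<union> F2) \<psi>"
proof -
  have r1: "\<psi> e = \<phi>1 e" "\<phi>1 e \<in> {1..m}" if "e \<in> F1" for e
    using that col1 by (auto simp: \<psi>_def edge_coloring_def)
  have r2: "\<psi> e = m + \<phi>2 e" "\<phi>2 e \<in> {1..n}" if "e \<in> F2" for e
    using that col2 assms(1) F1 F2 by (auto simp: \<psi>_def edge_coloring_def)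
  have cross: "\<psi> e \<noteq> \<psi> e'" if "e \<in> F1" "e' \<in> F2" for e e'
    using r1[OF that(1)] r2[OF that(2)] by auto
  have "\<psi> e \<in> {1..m + n}" if "e \<in> F1 \<union> F2" for e
    using that r1[of e] r2[of e] by auto
  then show "edge_coloring (F1 \<union> F2) (m + n) \<psi>"
    by (auto simp: edge_coloring_def)
  have FE: "F1 \<union> F2 \<subseteq> E1 \<union> E2"
    using F1 F2 by blast
  have "satisfied (E1 \<union> E2) (F1 \<union> F2) \<psi> u v" if uv: "{u, v} \<in> E1 \<union> E2" for u v
    using uv
  proof
    assume "{u, v} \<in> E1"
    then have "satisfied E1 F1 \<phi>1 u v"
      using sat1 by (simp add: all_satisfied_def)
    then obtain e where e: "e \<in> F1" "u \<in> e \<or> v \<in> e"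
      and uniq: "\<And>e'. e' \<in> F1 \<Longrightarrow> u \<in> e' \<or> v \<in> e' \<Longrightarrow> \<phi>1 e' = \<phi>1 e \<Longrightarrow> e' = e"
      unfolding satisfied_iff[OF F1] by blast
    have "e' = e" if "e' \<in> F1 \<union> F2" "u \<in> e' \<or> v \<in> e'" "\<psi> e' = \<psi> e" for e'
      using that uniq[of e'] cross[of e e'] r1(1)[of e] r1(1)[of e'] e(1) by auto
    then show ?thesis
      unfolding satisfied_iff[OF FE] using e by blast
  next
    assume "{u, v} \<in> E2"
    then have "satisfied E2 F2 \<phi>2 u v"
      using sat2 by (simp add: all_satisfied_def)
    then obtain e where e: "e \<in> F2" "u \<in> e \<or> v \<in> e"
      and uniq: "\<And>e'. e' \<in> F2 \<Longrightarrow> u \<in> e' \<or> v \<in> e' \<Longrightarrow> \<phi>2 e' = \<phi>2 e \<Longrightarrow> e' = e"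
      unfolding satisfied_iff[OF F2] by blast
    have "e' = e" if "e' \<in> F1 \<union> F2" "u \<in> e' \<or> v \<in> e'" "\<psi> e' = \<psi> e" for e'
      using that uniq[of e'] cross[of e' e] r2(1)[of e] r2(1)[of e'] e(1) by auto
    then show ?thesis
      unfolding satisfied_iff[OF FE] using e by blast
  qed
  then show "all_satisfied (E1 \<union> E2) (F1 \<union> F2) \<psi>"
    by (simp add: all_satisfied_def)
qed

text \<open>The edges whose ends have colors of different parity form a bipartite graph. On the remaining
  edges the last bit carries no information, so dropping it leaves a proper coloring with half as
  many colors.\<close>

lemma binary_partial_coloring:
  fixes E :: "'a set set" and c :: "'a \<Rightarrow> nat"
  assumes "finite (\<Union>E)"
    and "\<And>e. e \<in> E \<Longrightarrow> card e = 2"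
    and "\<And>u v. {u, v} \<in> E \<Longrightarrow> c u \<noteq> c v"
    and "\<And>v. v \<in> \<Union>E \<Longrightarrow> c v < 2 ^ k"
  shows "\<exists>F \<phi>. F \<subseteq> E \<and> edge_coloring F (2 * k) \<phi> \<and> all_satisfied E F \<phi>"
  using assms
proof (induction k arbitrary: E c)
  case 0
  have False if e: "e \<in> E" for e
  proof -
    obtain u v where uv: "e = {u, v}"
      using 0(2)[OF e] by (meson card_2_iff)
    then have "u \<in> \<Union>E" "v \<in> \<Union>E" "c u \<noteq> c v"
      using e 0(3) by auto
    then show False
      using 0(4)[of u] 0(4)[of v] by simp
  qed
  then have "E = {}"
    by blast
  then show ?case
    by (auto simp: edge_coloring_def all_satisfied_def)
next
  case (Suc k)
  define S where "S = {v. even (c v)}"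
  define E1 where "E1 = {e \<in> E. \<exists>u v. e = {u, v} \<and> u \<in> S \<and> v \<notin> S}"
  define E2 where "E2 = E - E1"
  have mixed: "{u, v} \<in> E1" if "{u, v} \<in> E" "u \<in> S" "v \<notin> S" for u v
    using that by (auto simp: E1_def)
  have sub: "E1 \<subseteq> E" "E2 \<subseteq> E" "E1 \<union> E2 = E" "E1 \<inter> E2 = {}"
    by (auto simp: E1_def E2_def)
  have fin: "finite (\<Union>E1)" "finite (\<Union>E2)"
    using Suc.prems(1) sub(1,2) by (meson Union_mono finite_subset)+
  have "(u \<in> S) \<noteq> (v \<in> S)" if "{u, v} \<in> E1" for u v
    using that by (auto simp: E1_def doubleton_eq_iff)
  then obtain F1 \<phi>1 where 1: "F1 \<subseteq> E1" "edge_coloring F1 2 \<phi>1" "all_satisfied E1 F1 \<phi>1"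
    using bipartite_two_colors[of E1 S] fin(1) Suc.prems(2) sub(1) by blast
  have "c u div 2 \<noteq> c v div 2" if uv: "{u, v} \<in> E2" for u v
  proof -
    have "{v, u} = {u, v}" "{u, v} \<in> E" "{u, v} \<notin> E1"
      using uv by (auto simp: E2_def)
    then have "u \<in> S \<longleftrightarrow> v \<in> S"
      using mixed[of u v] mixed[of v u] by metis
    then have "c u mod 2 = c v mod 2"
      by (simp add: S_def mod_2_eq_odd)
    moreover have "c u \<noteq> c v"
      using Suc.prems(3) uv sub(2) by blast
    ultimately show ?thesis
      by (metis div_mod_decomp)
  qed
  moreover have "c v div 2 < 2 ^ k" if "v \<in> \<Union>E2" for v
  proof -
    have "c v < 2 ^ Suc k"
      using that sub(2) Suc.prems(4) by blast
    then show ?thesis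
      by (simp add: less_mult_imp_div_less mult.commute)
  qed
  moreover have "card e = 2" if "e \<in> E2" for e
    using that Suc.prems(2) sub(2) by blast
  ultimately have "\<exists>F \<phi>. F \<subseteq> E2 \<and> edge_coloring F (2 * k) \<phi> \<and> all_satisfied E2 F \<phi>"
    by (intro Suc.IH[of E2 "\<lambda>v. c v div 2"] fin(2)) simp_all
  then obtain F2 \<phi>2
    where 2: "F2 \<subseteq> E2" "edge_coloring F2 (2 * k) \<phi>2" "all_satisfied E2 F2 \<phi>2"
    by blast
  note union = all_satisfied_disjoint_union[OF sub(4) 1(1) 2(1) 1(2) 2(2) 1(3) 2(3)]
  have "F1 \<union> F2 \<subseteq> E"
    using 1(1) 2(1) sub by blast
  then show ?case
    using union unfolding sub(3) mult_Suc_right by blast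
qed

section \<open>Total colorings and the two indices\<close>

text \<open>The color \<open>k + 1\<close> does not occur on \<open>F\<close>, so the newly colored edges cannot repeat a color
  that was seen exactly once.\<close>

lemma conflict_free_extension:
  assumes FE: "F \<subseteq> E" and col: "edge_coloring F k \<phi>" and sat: "all_satisfied E F \<phi>"
  defines "\<psi> \<equiv> \<lambda>e. if e \<in> F then \<phi> e else k + 1"
  shows "edge_coloring E (k + 1) \<psi>" and "conflict_free E \<psi>"
proof -
  have r: "\<phi> e \<in> {1..k}" if "e \<in> F" for e
    using that col by (auto simp: edge_coloring_def)
  have "\<psi> e \<in> {1..k + 1}" for e
    using r[of e] by (auto simp: \<psi>_def)
  then show "edge_coloring E (k + 1) \<psi>"
    by (auto simp: edge_coloring_def)
  have "satisfied E E \<psi> u v" if "{u, v} \<in> E" for u v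
  proof -
    have "satisfied E F \<phi> u v"
      using sat that by (simp add: all_satisfied_def)
    then obtain e where e: "e \<in> F" "u \<in> e \<or> v \<in> e"
      and uniq: "\<And>e'. e' \<in> F \<Longrightarrow> u \<in> e' \<or> v \<in> e' \<Longrightarrow> \<phi> e' = \<phi> e \<Longrightarrow> e' = e"
      unfolding satisfied_iff[OF FE] by blast
    have "e' = e" if "u \<in> e' \<or> v \<in> e'" "\<psi> e' = \<psi> e" for e'
      using that uniq[of e'] e(1) r[OF e(1)] by (auto simp: \<psi>_def split: if_splits)
    then show ?thesis
      unfolding satisfied_iff[OF subset_refl] using e FE by blast
  qed
  then show "conflict_free E \<psi>"
    by (simp add: conflict_free_def all_satisfied_def)
qed

lemma index_bounds_of_proper_coloring:
  assumes G: "simple_graph V E" and c: "proper_vertex_coloring V E n c" and "n \<le> 2 ^ k"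
  shows "scf_index V E \<le> 2 * k" and "cf_index E \<le> 2 * k + 1"
proof -
  have V: "finite V" and UV: "\<Union>E \<subseteq> V" and E: "\<And>e. e \<in> E \<Longrightarrow> card e = 2"
    using G by (auto simp: simple_graph_def)
  have range: "1 \<le> c v \<and> c v \<le> n" if "v \<in> \<Union>E" for v
  proof -
    have "c v \<in> {1..n}"
      using c UV that unfolding proper_vertex_coloring_def by blast
    then show ?thesis
      by simp
  qed
  \<comment> \<open>Colors start at 1, binary expansions of length \<open>k\<close> at 0.\<close>
  have "c u - 1 \<noteq> c v - 1" if "{u, v} \<in> E" for u v
  proof -
    have "u \<in> \<Union>E" "v \<in> \<Union>E"
      using that by blast+
    moreover have "c u \<noteq> c v"
      using c that unfolding proper_vertex_coloring_def by blast
    ultimately show ?thesis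
      using range[of u] range[of v] by linarith
  qed
  moreover have "c v - 1 < 2 ^ k" if "v \<in> \<Union>E" for v
    using range[OF that] \<open>n \<le> 2 ^ k\<close> by linarith
  ultimately have "\<exists>F \<phi>. F \<subseteq> E \<and> edge_coloring F (2 * k) \<phi> \<and> all_satisfied E F \<phi>"
    using finite_subset[OF UV V] E
    by (intro binary_partial_coloring[of E "\<lambda>v. c v - 1"]) simp_all
  then obtain F \<phi>
    where F: "F \<subseteq> E" "edge_coloring F (2 * k) \<phi>" "all_satisfied E F \<phi>"
    by blast
  have "subgraph V F V E"
    using G F(1) by (auto simp: subgraph_def simple_graph_def)
  then show "scf_index V E \<le> 2 * k"
    unfolding scf_index_def using F by (intro Least_le) blast
  show "cf_index E \<le> 2 * k + 1"
    unfolding cf_index_def using conflict_free_extension[OF F] by (intro Least_le) blast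
qed

theorem theorem1p4:
  fixes V :: "'a set" and E :: "'a set set"
  assumes "simple_graph V E"
    and "\<forall>v\<in>V. \<not> isolated E v"
  shows "int (scf_index V E) \<le> 2 * \<lceil>log 2 (real (chromatic_number V E))\<rceil>
    \<and> int (cf_index E) \<le> 2 * \<lceil>log 2 (real (chromatic_number V E))\<rceil> + 1"
proof -
  obtain k where k: "int k = \<lceil>log 2 (real (chromatic_number V E))\<rceil>"
    and le: "chromatic_number V E \<le> 2 ^ k"
    by (rule ceiling_log_two)
  obtain c where c: "proper_vertex_coloring V E (chromatic_number V E) c"
    using chromatic_number_attained[OF assms(1)] by blast
  show ?thesis
    using index_bounds_of_proper_coloring[OF assms(1) c le] unfolding k[symmetric] by simp
qed

end
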